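(* Let $(W,S)$ be a Coxeter system with $W$ finite and $S=\{s_i:i\in I\}$, let $w_\circ$ be the long element of $W$ (the unique element of maximum length), and let $i_N\cdots i_1$ be a reduced word for $w_\circ$ (so $w_\circ=s_{i_N}\cdots s_{i_1}$ with $N=\ell(w_\circ)$). Let $\mathscr L$ be a nonempty convex subset of $W$, and let $\tau_i\colon W\to W$ ($i\in I$) be the noninvertible Bender--Knuth toggles defined with respect to $\mathscr L$. Then $\tau_{i_N}\cdots\tau_{i_1}(W)=\mathscr L$.
   Context: Let $(W,S)$ be a Coxeter system with $S=\{s_i:i\in I\}$, $I$ a finite index set; $m(i,i')$ is the order of $s_is_{i'}$. The root space is $V=\mathbb R^I$ with standard basis the simple roots $\{\alpha_i:i\in I\}$ and symmetric bilinear form $B(\alpha_i,\alpha_{i'})=-\cos(\pi/m(i,i'))$ (and $-1$ if $m(i,i')=\infty$). $W$ acts on $V$ by $s_i\beta=\beta-2B(\beta,\alpha_i)\alpha_i$. The root system is $\Phi=\{w\alpha_i:w\in W,i\in I\}=\Phi^+\sqcup\Phi^-$, where $\Phi^+$ (positive roots) are those roots that are nonnegative combinations of simple roots and $\Phi^-=-\Phi^+$. For $\beta\in\Phi$ the half-space $H_\beta^+$ is $\{w\in W:w\beta\in\Phi^+\}$. A subset of $W$ is convex if it is an intersection of half-spaces (the empty intersection being $W$). For a nonempty convex set $\mathscr L\subseteq W$ let $\mathrm R(\mathscr L)=\{\beta\in\Phi:\mathscr L\subseteq H_\beta^+\}$. For $i\in I$, the noninvertible Bender--Knuth toggle $\tau_i\colon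 W\to W$ (with respect to $\mathscr L$) is defined by $\tau_i(u)=u$ if $u^{-1}\alpha_i\in\mathrm R(\mathscr L)$ and $\tau_i(u)=s_iu$ otherwise. Juxtaposition of toggles denotes composition of functions, applied right to left. *)

theory Defs
  imports Complex_Main "HOL-Algebra.Multiplicative_Group" "HOL-Algebra.Generated_Groups"
begin

text \<open>A word \<open>[i\<^sub>N, \<dots>, i\<^sub>1]\<close> denotes the product \<open>s i\<^sub>N \<otimes> \<dots> \<otimes> s i\<^sub>1\<close>.\<close>

definition word_prod :: "('a, 'b) monoid_scheme \<Rightarrow> ('i \<Rightarrow> 'a) \<Rightarrow> 'i list \<Rightarrow> 'a" where
  "word_prod G s ws = foldr (\<lambda>i g. s i \<otimes>\<^bsub>G\<^esub> g) ws \<one>\<^bsub>G\<^esub>"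

text \<open>
  The congruence on words generated by the Coxeter relations \<open>(i j)^(m i j) = 1\<close>. The value
  \<open>m i j = 0\<close> stands for infinity and contributes no relation. If \<open>m i i = 1\<close>, the
  relation \<open>[i, i] = []\<close> is included, so every letter is its own formal inverse and the quotient
  of the free monoid on \<open>I\<close> is the group presented by the Coxeter relations.\<close>

inductive coxeter_equiv :: "'i set \<Rightarrow> ('i \<Rightarrow> 'i \<Rightarrow> nat) \<Rightarrow> 'i list \<Rightarrow> 'i list \<Rightarrow> bool"
  for I :: "'i set" and m :: "'i \<Rightarrow> 'i \<Rightarrow> nat" where
  rel: "i \<in> I \<Longrightarrow> j \<in> I \<Longrightarrow> coxeter_equiv I m (concat (replicate (m i j) [i, j])) []"
| refl: "coxeter_equiv I m xs xs"
| sym: "coxeter_equiv I m xs ys \<Longrightarrow> coxeter_equiv I m ys xs"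
| trans: "coxeter_equiv I m xs ys \<Longrightarrow> coxeter_equiv I m ys zs \<Longrightarrow> coxeter_equiv I m xs zs"
| append: "coxeter_equiv I m xs ys \<Longrightarrow> coxeter_equiv I m us vs \<Longrightarrow>
    coxeter_equiv I m (xs @ us) (ys @ vs)"

text \<open>
  A Coxeter system: the simple reflections \<open>s i\<close> are pairwise distinct elements of order 2 that
  generate \<open>W\<close>, and together with the relations \<open>(s i \<otimes> s j)\<^sup>m = 1\<close>, where \<open>m\<close> is the order of
  \<open>s i \<otimes> s j\<close>, they give a presentation of \<open>W\<close>. Note that \<open>ord\<close> is 0 for elements of infinite
  order.\<close>

locale coxeter_system = group W for W (structure) +
  fixes I :: "'i set" and s :: "'i \<Rightarrow> 'a"
  assumes finite_index: "finite I"
    and refl_closed: "i \<in> I \<Longrightarrow> s i \<in> carrier W"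
    and refl_inj: "inj_on s I"
    and refl_ord: "i \<in> I \<Longrightarrow> ord (s i) = 2"
    and generates: "generate W (s ` I) = carrier W"
    and presentation: "set ws \<subseteq> I \<Longrightarrow> word_prod W s ws = \<one> \<Longrightarrow>
      coxeter_equiv I (\<lambda>i j. ord (s i \<otimes> s j)) ws []"
begin

definition cox_m :: "'i \<Rightarrow> 'i \<Rightarrow> nat" where
  "cox_m i j = ord (s i \<otimes> s j)"

definition is_word :: "'i list \<Rightarrow> 'a \<Rightarrow> bool" where
  "is_word ws w \<longleftrightarrow> set ws \<subseteq> I \<and> word_prod W s ws = w"

definition cox_length :: "'a \<Rightarrow> nat" where
  "cox_length w = (LEAST n. \<exists>ws. is_word ws w \<and> length ws = n)"

definition is_reduced_word :: "'i list \<Rightarrow> 'a \<Rightarrow> bool" where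
  "is_reduced_word ws w \<longleftrightarrow> is_word ws w \<and> length ws = cox_length w"

definition long_element :: 'a where
  "long_element = (THE w. w \<in> carrier W \<and> (\<forall>v\<in>carrier W. cox_length v \<le> cox_length w))"

text \<open>
  Vectors of the root space \<open>\<real>\<^sup>I\<close> are functions \<open>'i \<Rightarrow> real\<close> vanishing outside \<open>I\<close>; all roots
  are of this kind.\<close>

definition simple_root :: "'i \<Rightarrow> 'i \<Rightarrow> real" where
  "simple_root i = (\<lambda>j. if j = i then 1 else 0)"

definition gram :: "'i \<Rightarrow> 'i \<Rightarrow> real" where
  "gram i j = (if cox_m i j = 0 then - 1 else - cos (pi / real (cox_m i j)))"

definition bilin :: "('i \<Rightarrow> real) \<Rightarrow> ('i \<Rightarrow> real) \<Rightarrow> real" where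
  "bilin \<beta> \<gamma> = (\<Sum>i\<in>I. \<Sum>j\<in>I. \<beta> i * \<gamma> j * gram i j)"

definition reflect :: "'i \<Rightarrow> ('i \<Rightarrow> real) \<Rightarrow> 'i \<Rightarrow> real" where
  "reflect i \<beta> = (\<lambda>j. \<beta> j - 2 * bilin \<beta> (simple_root i) * simple_root i j)"

text \<open>
  The action of \<open>W\<close> on the root space, computed from a word for \<open>w\<close>. The choice of the word is
  immaterial, because the maps \<open>reflect i\<close> satisfy the Coxeter relations on the root space.\<close>

definition act :: "'a \<Rightarrow> ('i \<Rightarrow> real) \<Rightarrow> 'i \<Rightarrow> real" where
  "act w \<beta> = foldr reflect (SOME ws. is_word ws w) \<beta>"

definition roots :: "('i \<Rightarrow> real) set" where
  "roots = {act w (simple_root i) |w i. w \<in> carrier W \<and> i \<in> I}"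

definition pos_roots :: "('i \<Rightarrow> real) set" where
  "pos_roots = {\<beta> \<in> roots. \<forall>i\<in>I. \<beta> i \<ge> 0}"

definition half_space :: "('i \<Rightarrow> real) \<Rightarrow> 'a set" where
  "half_space \<beta> = {w \<in> carrier W. act w \<beta> \<in> pos_roots}"

definition is_convex :: "'a set \<Rightarrow> bool" where
  "is_convex L \<longleftrightarrow> (\<exists>A \<subseteq> roots. L = carrier W \<inter> (\<Inter>\<beta>\<in>A. half_space \<beta>))"

definition root_set :: "'a set \<Rightarrow> ('i \<Rightarrow> real) set" where
  "root_set L = {\<beta> \<in> roots. L \<subseteq> half_space \<beta>}"

text \<open>The noninvertible Bender--Knuth toggle.\<close>

definition toggle :: "'a set \<Rightarrow> 'i \<Rightarrow> 'a \<Rightarrow> 'a" where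
  "toggle L i u = (if act (inv u) (simple_root i) \<in> root_set L then u else s i \<otimes> u)"

end

end

theory Submission
  imports Defs
begin

text \<open>
  For \<open>\<beta> \<in> R(L)\<close>, a toggle never moves an element out of the half-space of \<open>\<beta>\<close>; hence every
  toggle maps \<open>L\<close> to \<open>L\<close>, where it is an involution, and \<open>L\<close> is contained in the image. For the
  converse let \<open>u\<^sub>k\<close> be the element obtained from an arbitrary \<open>u\<^sub>0\<close> after \<open>k\<close> toggles and put
  \<open>w\<^sub>k = s i\<^sub>k \<otimes> \<dots> \<otimes> s i\<^sub>1\<close>. By induction on \<open>k\<close>, every \<open>\<beta> \<in> R(L)\<close> satisfies: \<open>u\<^sub>k \<beta>\<close> is
  positive or \<open>w\<^sub>k\<^sup>-\<^sup>1 u\<^sub>k \<beta>\<close> is negative. The only difficult case is that the toggle fixes \<open>u\<^sub>k\<close>,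
  so that \<open>\<beta>' = u\<^sub>k\<^sup>-\<^sup>1 \<alpha>\<close> lies in \<open>R(L)\<close>, where \<open>\<alpha>\<close> is the simple root of the toggle, and that
  \<open>B(\<beta>, \<beta>') < 0\<close>; then the reflection of \<open>\<beta>\<close> in \<open>\<beta>'\<close> lies in \<open>R(L)\<close> too, and the induction
  hypothesis is applied to it. At the end \<open>w\<^sub>N\<close> is the long element, which exchanges positive and
  negative roots, so \<open>u\<^sub>N \<beta>\<close> is positive for all \<open>\<beta> \<in> R(L)\<close>, that is, \<open>u\<^sub>N \<in> L\<close>.\<close>

section \<open>Words and lengths\<close>

text \<open>Every Coxeter relator \<open>(i j)^m\<close> has even length, so parity is an invariant
  of the congruence. This is the sign character in terms of words.\<close>

lemma coxeter_equiv_even_length: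
  "coxeter_equiv I m xs ys \<Longrightarrow> even (length xs) = even (length ys)"
proof (induction rule: coxeter_equiv.induct)
  case (rel i j)
  have "length (concat (replicate n [i, j])) = 2 * n" for n by (induction n) auto
  then show ?case by simp
qed auto

text \<open>Letters are prepended, so a nonempty word always ends in \<open>j\<close>, and
  \<open>foldr reflect\<close> on longer words adds one reflection at a time on the outside.\<close>

fun alt_word :: "'i \<Rightarrow> 'i \<Rightarrow> nat \<Rightarrow> 'i list" where
  "alt_word i j 0 = []"
| "alt_word i j (Suc k) = (if even k then j else i) # alt_word i j k"

lemma length_alt_word [simp]: "length (alt_word i j k) = k"
  by (induction k) auto

lemma set_alt_word: "set (alt_word i j k) \<subseteq> {i, j}"
  by (induction k) auto

lemma alt_word_snoc: "alt_word i j (Suc k) = alt_word j i k @ [j]"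
  by (induction k) auto

lemma alt_word_even: "alt_word i j (2 * n) = concat (replicate n [i, j])"
  by (induction n) auto

lemma alt_word_add: "\<exists>xs. alt_word i j (k + l) = xs @ alt_word i j l \<and> length xs = k \<and> set xs \<subseteq> {i, j}"
proof (induction k)
  case (Suc k)
  then obtain xs where "alt_word i j (k + l) = xs @ alt_word i j l" "length xs = k" "set xs \<subseteq> {i, j}"
    by blast
  then show ?case
    by (intro exI[of _ "(if even (k + l) then j else i) # xs"]) auto
qed simp

text \<open>The word \<open>i j i j ...\<close> starts with \<open>i\<close>, so its first
  \<open>k\<close> letters read backwards alternate and end in \<open>i\<close>. Cutting in the
  middle turns the Coxeter relation into the braid relation.\<close>

lemma alt_word_even_split:
  "k \<le> 2 * n \<Longrightarrow> alt_word i j (2 * n) = rev (alt_word j i k) @ alt_word i j (2 * n - k)"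
proof (induction k)
  case (Suc k)
  then have "2 * n - k = Suc (2 * n - Suc k)" by simp
  moreover have "even (2 * n - Suc k) \<longleftrightarrow> odd k" using Suc.prems by auto
  ultimately show ?case using Suc by simp
qed simp

context coxeter_system
begin

section \<open>Word products and the length function\<close>

lemma s_mult_s [simp]: "i \<in> I \<Longrightarrow> s i \<otimes> s i = \<one>"
  using pow_ord_eq_1[of "s i"] refl_ord[of i] refl_closed[of i] by (simp add: numeral_2_eq_2)

lemma inv_s [simp]: "i \<in> I \<Longrightarrow> inv (s i) = s i"
  by (simp add: inv_equality refl_closed)

lemma mult_s_s [simp]: "i \<in> I \<Longrightarrow> w \<in> carrier W \<Longrightarrow> w \<otimes> s i \<otimes> s i = w"
  by (simp add: m_assoc refl_closed)

lemma s_mult_s_mult [simp]: "i \<in> I \<Longrightarrow> w \<in> carrier W \<Longrightarrow> s i \<otimes> (s i \<otimes> w) = w"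
  by (simp add: refl_closed flip: m_assoc)

lemma word_prod_Nil [simp]: "word_prod W s [] = \<one>"
  by (simp add: word_prod_def)

lemma word_prod_Cons [simp]: "word_prod W s (i # ws) = s i \<otimes> word_prod W s ws"
  by (simp add: word_prod_def)

lemma word_prod_closed [simp]: "set ws \<subseteq> I \<Longrightarrow> word_prod W s ws \<in> carrier W"
  by (induction ws) (auto simp: refl_closed)

lemma word_prod_append:
  "set xs \<subseteq> I \<Longrightarrow> set ys \<subseteq> I \<Longrightarrow> word_prod W s (xs @ ys) = word_prod W s xs \<otimes> word_prod W s ys"
  by (induction xs) (auto simp: refl_closed m_assoc)

lemma word_prod_rev: "set ws \<subseteq> I \<Longrightarrow> word_prod W s (rev ws) = inv (word_prod W s ws)"
  by (induction ws) (auto simp: word_prod_append refl_closed inv_mult_group)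

lemma ex_word:
  assumes "w \<in> carrier W"
  shows "\<exists>ws. is_word ws w"
proof -
  have "w \<in> generate W (s ` I)" using assms generates by simp
  then show ?thesis
  proof (induction rule: generate.induct)
    case one
    show ?case by (intro exI[of _ "[]"]) (simp add: is_word_def)
  next
    case (incl h)
    then obtain i where "i \<in> I" "h = s i" by auto
    then show ?case by (intro exI[of _ "[i]"]) (simp add: is_word_def refl_closed)
  next
    case (inv h)
    then obtain i where "i \<in> I" "h = s i" by auto
    then show ?case by (intro exI[of _ "[i]"]) (simp add: is_word_def refl_closed)
  next
    case (eng g h)
    then obtain xs ys where "is_word xs g" "is_word ys h" by auto
    then show ?case by (intro exI[of _ "xs @ ys"]) (simp add: is_word_def word_prod_append)
  qed
qed

lemma ex_reduced_word:
  assumes "w \<in> carrier W"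
  shows "\<exists>ws. is_reduced_word ws w"
  unfolding is_reduced_word_def cox_length_def
  using LeastI_ex[of "\<lambda>n. \<exists>ws. is_word ws w \<and> length ws = n"] ex_word[OF assms] by blast

lemma cox_length_le: "is_word ws w \<Longrightarrow> cox_length w \<le> length ws"
  unfolding cox_length_def by (rule Least_le) blast

lemma cox_length_mult_le:
  assumes "v \<in> carrier W" "w \<in> carrier W"
  shows "cox_length (v \<otimes> w) \<le> cox_length v + cox_length w"
proof -
  obtain xs ys where "is_reduced_word xs v" "is_reduced_word ys w"
    using assms ex_reduced_word by meson
  then have "is_word (xs @ ys) (v \<otimes> w)" "length (xs @ ys) = cox_length v + cox_length w"
    by (auto simp: is_reduced_word_def is_word_def word_prod_append)
  then show ?thesis using cox_length_le by metis
qed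

lemma cox_length_inv:
  assumes "w \<in> carrier W"
  shows "cox_length (inv w) = cox_length w"
proof -
  have le: "cox_length (inv v) \<le> cox_length v" if v: "v \<in> carrier W" for v
  proof -
    obtain xs where "is_reduced_word xs v" using ex_reduced_word[OF v] ..
    then have "is_word (rev xs) (inv v)" "length (rev xs) = cox_length v"
      by (auto simp: is_reduced_word_def is_word_def word_prod_rev)
    then show ?thesis using cox_length_le by metis
  qed
  from le[OF assms] le[of "inv w"] assms show ?thesis by simp
qed

text \<open>The word \<open>xs @ rev ys\<close> represents the identity, so by the presentation it
  is congruent to the empty word and has even length.\<close>

lemma word_parity:
  assumes "is_word xs w" "is_word ys w"
  shows "even (length xs) = even (length ys)"
proof -
  have "word_prod W s (xs @ rev ys) = \<one>" "set (xs @ rev ys) \<subseteq> I"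
    using assms by (auto simp: is_word_def word_prod_append word_prod_rev)
  from coxeter_equiv_even_length[OF presentation[OF this(2,1)]] show ?thesis by simp
qed

text \<open>Multiplying by a generator changes the length by at most one, and parity excludes
  equality.\<close>

lemma cox_length_mult_s:
  assumes "w \<in> carrier W" "i \<in> I"
  shows "cox_length (w \<otimes> s i) = Suc (cox_length w) \<or> cox_length w = Suc (cox_length (w \<otimes> s i))"
proof -
  have le: "cox_length (v \<otimes> s i) \<le> Suc (cox_length v)" if "v \<in> carrier W" for v
    using cox_length_mult_le[OF that refl_closed[OF assms(2)]]
      cox_length_le[of "[i]" "s i"] assms(2) by (simp add: is_word_def refl_closed)
  obtain xs ys where xs: "is_reduced_word xs w" and ys: "is_reduced_word ys (w \<otimes> s i)"
    using assms ex_reduced_word by (meson m_closed refl_closed)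
  then have "is_word (xs @ [i]) (w \<otimes> s i)"
    using assms by (auto simp: is_reduced_word_def is_word_def word_prod_append refl_closed)
  from word_parity[OF this, of ys] have "even (length (xs @ [i])) = even (length ys)"
    using ys by (simp add: is_reduced_word_def)
  then have "cox_length (w \<otimes> s i) \<noteq> cox_length w"
    using xs ys by (auto simp: is_reduced_word_def)
  then show ?thesis using le[of w] le[of "w \<otimes> s i"] assms
    by (simp add: refl_closed) linarith
qed

lemma reduced_word_tl:
  assumes "is_reduced_word (i # ws) w"
  shows "is_reduced_word ws (word_prod W s ws)"
    and "cox_length (word_prod W s ws) < cox_length (s i \<otimes> word_prod W s ws)"
proof -
  have i: "i \<in> I" "set ws \<subseteq> I" and w: "w = s i \<otimes> word_prod W s ws"
    and len: "cox_length w = Suc (length ws)"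
    using assms by (auto simp: is_reduced_word_def is_word_def)
  have word: "is_word ws (word_prod W s ws)" using i by (simp add: is_word_def)
  have "cox_length w \<le> Suc (cox_length (word_prod W s ws))"
    using cox_length_mult_le[of "s i" "word_prod W s ws"] cox_length_le[of "[i]" "s i"] i w
    by (simp add: is_word_def refl_closed)
  then show "is_reduced_word ws (word_prod W s ws)"
    using cox_length_le[OF word] len word by (simp add: is_reduced_word_def)
  then show "cox_length (word_prod W s ws) < cox_length (s i \<otimes> word_prod W s ws)"
    using len w by (simp add: is_reduced_word_def)
qed

text \<open>The last letter of a reduced word is a right descent.\<close>

lemma ex_shorter_mult_s:
  assumes "w \<in> carrier W" "w \<noteq> \<one>"
  shows "\<exists>i\<in>I. cox_length (w \<otimes> s i) < cox_length w"
proof -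
  obtain ws where ws: "is_reduced_word ws w" using ex_reduced_word[OF assms(1)] ..
  then have "ws \<noteq> []" using assms(2) by (auto simp: is_reduced_word_def is_word_def)
  then obtain xs i where ws_eq: "ws = xs @ [i]" by (metis rev_exhaust)
  then have i: "i \<in> I" "set xs \<subseteq> I" and w: "w = word_prod W s xs \<otimes> s i"
    using ws by (auto simp: is_reduced_word_def is_word_def word_prod_append refl_closed)
  then have "is_word xs (w \<otimes> s i)" by (simp add: is_word_def)
  from cox_length_le[OF this] have "cox_length (w \<otimes> s i) < cox_length w"
    using ws ws_eq by (simp add: is_reduced_word_def)
  with i(1) show ?thesis ..
qed

section \<open>The geometric representation\<close>

lemma cox_m_commute:
  assumes "i \<in> I" "j \<in> I"
  shows "cox_m i j = cox_m j i"
  using ord_inv[of "s i \<otimes> s j"] assms by (simp add: cox_m_def inv_mult_group refl_closed)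

lemma cox_m_self: "i \<in> I \<Longrightarrow> cox_m i i = 1"
  by (simp add: cox_m_def)

text \<open>Follows from the injectivity of \<open>s\<close>; it keeps \<open>sin (pi / m)\<close>
  away from zero in the dihedral formulas.\<close>

lemma cox_m_neq_1:
  assumes "i \<in> I" "j \<in> I" "i \<noteq> j"
  shows "cox_m i j \<noteq> 1"
proof
  assume "cox_m i j = 1"
  then have "s i \<otimes> s j = \<one>" using assms ord_eq_1[of "s i \<otimes> s j"] by (simp add: cox_m_def refl_closed)
  then have "s i = inv (s j)" using assms inv_equality[of "s i" "s j"] by (simp add: refl_closed)
  then have "i = j" using assms refl_inj by (simp add: inj_on_def)
  with assms show False by simp
qed

lemma gram_commute: "i \<in> I \<Longrightarrow> j \<in> I \<Longrightarrow> gram i j = gram j i"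
  by (simp add: gram_def cox_m_commute)

lemma gram_self: "i \<in> I \<Longrightarrow> gram i i = 1"
  by (simp add: gram_def cox_m_self)

lemma bilin_commute: "bilin \<beta> \<gamma> = bilin \<gamma> \<beta>"
  unfolding bilin_def
  by (subst sum.swap) (auto intro!: sum.cong simp: gram_commute)

lemma bilin_linear_left: "bilin (\<lambda>x. a * \<beta> x + b * \<gamma> x) \<delta> = a * bilin \<beta> \<delta> + b * bilin \<gamma> \<delta>"
  by (simp add: bilin_def algebra_simps sum.distrib sum_distrib_left)

lemma bilin_linear_right: "bilin \<delta> (\<lambda>x. a * \<beta> x + b * \<gamma> x) = a * bilin \<delta> \<beta> + b * bilin \<delta> \<gamma>"
  by (simp add: bilin_commute[of \<delta>] bilin_linear_left)

lemma bilin_simple: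
  assumes "i \<in> I" "j \<in> I"
  shows "bilin (simple_root i) (simple_root j) = gram i j"
proof -
  have "bilin (simple_root i) (simple_root j)
      = (\<Sum>k\<in>I. if k = i then (\<Sum>l\<in>I. if l = j then gram k l else 0) else 0)"
    unfolding bilin_def simple_root_def by (auto intro!: sum.cong)
  then show ?thesis using assms finite_index by simp
qed

text \<open>The factor 1 gives the right-hand side the shape
  \<open>a * \<beta> x + b * \<gamma> x\<close> on which the linearity lemmas rewrite.\<close>

lemma reflect_eq:
  "reflect i \<beta> = (\<lambda>x. 1 * \<beta> x + (- 2 * bilin \<beta> (simple_root i)) * simple_root i x)"
  by (simp add: reflect_def)

lemma bilin_reflect:
  assumes "i \<in> I"
  shows "bilin (reflect i \<beta>) (reflect i \<gamma>) = bilin \<beta> \<gamma>"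
  unfolding reflect_eq bilin_linear_left bilin_linear_right
  by (simp add: bilin_simple gram_self assms bilin_commute[of "simple_root i" \<gamma>])

lemma reflect_linear:
  "reflect i (\<lambda>x. a * \<beta> x + b * \<gamma> x) = (\<lambda>x. a * reflect i \<beta> x + b * reflect i \<gamma> x)"
  by (simp add: reflect_def bilin_linear_left algebra_simps)

lemma reflect_simple_self:
  assumes "i \<in> I"
  shows "reflect i (simple_root i) = (\<lambda>x. - simple_root i x)"
  using assms by (simp add: reflect_def bilin_simple gram_self)

lemma reflect_reflect:
  assumes "i \<in> I"
  shows "reflect i (reflect i \<beta>) = \<beta>"
proof -
  have "bilin (reflect i \<beta>) (simple_root i) = - bilin \<beta> (simple_root i)"
    unfolding reflect_eq bilin_linear_left by (simp add: bilin_simple gram_self assms)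
  then show ?thesis by (simp add: reflect_def fun_eq_iff)
qed

lemma foldr_reflect_linear:
  "foldr reflect ws (\<lambda>x. a * \<beta> x + b * \<gamma> x)
    = (\<lambda>x. a * foldr reflect ws \<beta> x + b * foldr reflect ws \<gamma> x)"
  by (induction ws) (simp_all add: reflect_linear)

lemma foldr_reflect_rev:
  "set ws \<subseteq> I \<Longrightarrow> foldr reflect ws (foldr reflect (rev ws) \<beta>) = \<beta>"
proof (induction ws arbitrary: \<beta>)
  case (Cons i ws)
  then show ?case by (simp add: reflect_reflect)
qed simp

lemma bilin_foldr_reflect:
  "set ws \<subseteq> I \<Longrightarrow> bilin (foldr reflect ws \<beta>) (foldr reflect ws \<gamma>) = bilin \<beta> \<gamma>"
  by (induction ws) (simp_all add: bilin_reflect)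

text \<open>
  The coefficients of the roots of the dihedral subgroup generated by \<open>s i\<close> and \<open>s j\<close>, by their
  depth \<open>k\<close>.\<close>

definition dihedral_coeff :: "'i \<Rightarrow> 'i \<Rightarrow> nat \<Rightarrow> real" where
  "dihedral_coeff i j k = (if cox_m i j = 0 then real k
    else sin (real k * (pi / real (cox_m i j))) / sin (pi / real (cox_m i j)))"

lemma sin_pi_over_pos: "cox_m i j \<noteq> 0 \<Longrightarrow> cox_m i j \<noteq> 1 \<Longrightarrow> 0 < sin (pi / real (cox_m i j))"
  by (rule sin_gt_zero) (auto simp: field_simps)

lemma dihedral_coeff_simps [simp]:
  assumes "i \<in> I" "j \<in> I" "i \<noteq> j"
  shows "dihedral_coeff i j 0 = 0" "dihedral_coeff i j (Suc 0) = 1"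
proof -
  have "sin (pi / real (cox_m i j)) \<noteq> 0" if "cox_m i j \<noteq> 0"
    using sin_pi_over_pos[OF that cox_m_neq_1[OF assms]] by simp
  then show "dihedral_coeff i j 0 = 0" "dihedral_coeff i j (Suc 0) = 1"
    by (auto simp: dihedral_coeff_def)
qed

text \<open>For finite order this is \<open>sin (a + t) + sin (a - t) = 2 * cos t * sin a\<close>,
  the Chebyshev recurrence; for infinite order \<open>gram i j = - 1\<close> and the coefficients
  grow linearly.\<close>

lemma dihedral_coeff_rec:
  "dihedral_coeff i j (Suc (Suc k))
    = - 2 * gram i j * dihedral_coeff i j (Suc k) - dihedral_coeff i j k"
proof (cases "cox_m i j = 0")
  case False
  define t where "t = pi / real (cox_m i j)"
  have "sin (real (Suc (Suc k)) * t) = sin (real (Suc k) * t + t)"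
       "sin (real k * t) = sin (real (Suc k) * t - t)"
    by (simp_all add: algebra_simps)
  then have "sin (real (Suc (Suc k)) * t) = 2 * cos t * sin (real (Suc k) * t) - sin (real k * t)"
    by (simp only: sin_add sin_diff) (simp add: algebra_simps)
  then have "sin (real (Suc (Suc k)) * t) / sin t
      = 2 * cos t * (sin (real (Suc k) * t) / sin t) - sin (real k * t) / sin t"
    by (simp only: diff_divide_distrib times_divide_eq_right)
  then show ?thesis using False by (simp add: dihedral_coeff_def gram_def t_def)
qed (simp add: dihedral_coeff_def gram_def algebra_simps)

text \<open>Up to \<open>k = cox_m i j\<close> the angle \<open>k * pi / m\<close> stays in the
  interval from 0 to \<open>pi\<close>, where the sine is nonnegative.\<close>

lemma dihedral_coeff_nonneg:
  assumes "i \<in> I" "j \<in> I" "i \<noteq> j" "cox_m i j = 0 \<or> k \<le> cox_m i j"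
  shows "0 \<le> dihedral_coeff i j k"
proof (cases "cox_m i j = 0")
  case False
  then have "real k * (pi / real (cox_m i j)) \<le> pi" using assms(4) by (simp add: field_simps)
  then show ?thesis
    using False sin_pi_over_pos[OF False cox_m_neq_1] assms
    by (auto simp: dihedral_coeff_def intro!: divide_nonneg_pos sin_ge_zero)
qed (simp add: dihedral_coeff_def)

text \<open>Each new reflection keeps the coefficient of one simple root and replaces the other by
  the next term of the recurrence.\<close>

lemma foldr_reflect_alt_word:
  assumes "i \<in> I" "j \<in> I" "i \<noteq> j"
  shows "foldr reflect (alt_word i j k) (simple_root i)
    = (\<lambda>x. dihedral_coeff i j (Suc k) * simple_root (if even k then i else j) x
         + dihedral_coeff i j k * simple_root (if even k then j else i) x)"
proof (induction k)
  case 0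
  then show ?case using assms by simp
next
  case (Suc k)
  let ?p = "if even k then i else j" and ?q = "if even k then j else i"
  have q: "?q \<in> I" "?p \<in> I" and g: "gram ?p ?q = gram i j"
    using assms by (auto simp: gram_commute)
  have "reflect ?q (simple_root ?p) = (\<lambda>x. simple_root ?p x - 2 * gram i j * simple_root ?q x)"
    unfolding reflect_def bilin_simple[OF q(2,1)] g ..
  then show ?case
    using Suc.IH
    by (simp only: alt_word.simps foldr.simps o_apply reflect_linear reflect_simple_self[OF q(1)]
        dihedral_coeff_rec) (simp add: fun_eq_iff algebra_simps)
qed

text \<open>The two simple roots are fixed by the explicit coefficients. For finite order the form
  is nondegenerate on their plane, so any vector splits into a part in the plane and a part
  orthogonal to it, which both reflections fix.\<close>

lemma foldr_reflect_braid:
  assumes ij: "i \<in> I" "j \<in> I" "i \<noteq> j" and m: "cox_m i j \<noteq> 0"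
  shows "foldr reflect (alt_word i j (2 * cox_m i j)) \<beta> = \<beta>"
proof -
  let ?m = "cox_m i j" and ?g = "gram i j"
  let ?T = "foldr reflect (alt_word i j (2 * ?m))"
  define t where "t = pi / real ?m"
  have sin_t: "0 < sin t" unfolding t_def by (rule sin_pi_over_pos[OF m cox_m_neq_1[OF ij]])
  have mt: "real ?m * t = pi" using m by (simp add: t_def)
  obtain n where n: "2 * ?m = Suc n" using m by (cases "2 * ?m") auto
  then have odd_n: "odd n" by (metis even_Suc even_mult_iff even_numeral)
  have mt': "real (Suc n) * t = 2 * pi" unfolding n[symmetric] using mt by simp
  have "sin (real n * t) = sin (real (Suc n) * t - t)" by (simp add: algebra_simps)
  then have sin1: "sin (real n * t) = - sin t" unfolding mt' by (simp add: sin_diff)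
  have "sin (real (Suc (Suc n)) * t) = sin (real (Suc n) * t + t)" by (simp add: algebra_simps)
  then have sin2: "sin (real (Suc (Suc n)) * t) = sin t" unfolding mt' by (simp add: sin_add)
  have "dihedral_coeff i j k = sin (real k * t) / sin t"
    "dihedral_coeff j i k = sin (real k * t) / sin t" for k
    using m cox_m_commute[OF ij(1,2)] by (simp_all add: dihedral_coeff_def t_def)
  then have coeff: "dihedral_coeff i j (Suc n) = 0" "dihedral_coeff i j (Suc (Suc n)) = 1"
    "dihedral_coeff j i (Suc n) = 0" "dihedral_coeff j i n = - 1"
    using sin_t by (simp_all only: sin1 sin2 mt') simp_all
  have Ti: "?T (simple_root i) = simple_root i"
    unfolding n foldr_reflect_alt_word[OF ij] coeff using odd_n by simp
  \<comment> \<open>The last letter \<open>j\<close> acts first and negates its root. What remains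
    is a word of length \<open>n = 2 * ?m - 1\<close> ending in \<open>i\<close>, so the coefficient
    formula applies with \<open>i\<close> and \<open>j\<close> exchanged. The summand with factor 0
    pads the vector to the shape of \<open>foldr_reflect_linear\<close>.\<close>
  have "?T (simple_root j) = foldr reflect (alt_word j i n) (\<lambda>x. (- 1) * simple_root j x + 0 * \<beta> x)"
    unfolding n alt_word_snoc using ij by (simp add: reflect_simple_self)
  also have "\<dots> = simple_root j"
    unfolding foldr_reflect_linear foldr_reflect_alt_word[OF ij(2,1) ij(3)[symmetric]] coeff
    using odd_n by simp
  finally have Tj: "?T (simple_root j) = simple_root j" .
  \<comment> \<open>\<open>D\<close> is the Gram determinant of the plane. By Cramer's rule
    \<open>c\<close> and \<open>d\<close> are the coordinates of the orthogonal projection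
    \<open>\<epsilon>\<close> of \<open>\<beta>\<close>.\<close>
  define D where "D = 1 - ?g\<^sup>2"
  have "D = (sin t)\<^sup>2" using m by (simp add: D_def gram_def t_def sin_squared_eq)
  with sin_t have D: "D \<noteq> 0" by simp
  define c where "c = (bilin \<beta> (simple_root i) - ?g * bilin \<beta> (simple_root j)) / D"
  define d where "d = (bilin \<beta> (simple_root j) - ?g * bilin \<beta> (simple_root i)) / D"
  define \<epsilon> where "\<epsilon> = (\<lambda>x. c * simple_root i x + d * simple_root j x)"
  define \<delta> where "\<delta> = (\<lambda>x. 1 * \<beta> x + (- 1) * \<epsilon> x)"
  have "c + d * ?g = bilin \<beta> (simple_root i)" "c * ?g + d = bilin \<beta> (simple_root j)"
    using D by (simp_all add: c_def d_def field_simps) (simp_all add: D_def algebra_simps power2_eq_square)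
  then have "bilin \<delta> (simple_root i) = 0" "bilin \<delta> (simple_root j) = 0"
    unfolding \<delta>_def \<epsilon>_def bilin_linear_left
    using ij by (simp_all add: bilin_simple gram_self gram_commute[of j i])
  then have "reflect i \<delta> = \<delta>" "reflect j \<delta> = \<delta>" by (simp_all add: reflect_def)
  then have "foldr reflect xs \<delta> = \<delta>" if "set xs \<subseteq> {i, j}" for xs
    using that by (induction xs) auto
  then have "?T \<delta> = \<delta>" by (simp add: set_alt_word)
  moreover have "?T \<epsilon> = \<epsilon>" unfolding \<epsilon>_def foldr_reflect_linear Ti Tj ..
  ultimately have "?T (\<lambda>x. 1 * \<delta> x + 1 * \<epsilon> x) = (\<lambda>x. 1 * \<delta> x + 1 * \<epsilon> x)"
    by (simp only: foldr_reflect_linear)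
  then show ?thesis by (simp add: \<delta>_def)
qed

lemma coxeter_equiv_foldr_reflect:
  "coxeter_equiv I (\<lambda>i j. ord (s i \<otimes> s j)) xs ys \<Longrightarrow> foldr reflect xs = foldr reflect ys"
proof (induction rule: coxeter_equiv.induct)
  case (rel i j)
  show ?case
  proof (cases "i = j \<or> cox_m i j = 0")
    \<comment> \<open>If \<open>i = j\<close>, the relator is \<open>[i, i]\<close> and a reflection
      is an involution; if the order is infinite, the relator is empty.\<close>
    case True
    then show ?thesis
      using rel cox_m_self[of i] by (auto simp: fun_eq_iff cox_m_def reflect_reflect)
  next
    case False
    then show ?thesis
      using foldr_reflect_braid[of i j] rel
      by (simp add: fun_eq_iff cox_m_def flip: alt_word_even)
  qed
qed auto

text \<open>Makes the choice of a word in \<open>act\<close> immaterial: the chosen word followed by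
  \<open>rev ws\<close> represents the identity, hence acts trivially by the presentation.\<close>

lemma act_word:
  assumes "is_word ws w"
  shows "act w \<beta> = foldr reflect ws \<beta>"
proof -
  define vs where "vs = (SOME ws. is_word ws w)"
  have vs: "is_word vs w" unfolding vs_def using assms by (rule someI)
  have sets: "set vs \<subseteq> I" "set ws \<subseteq> I" using vs assms by (auto simp: is_word_def)
  have "word_prod W s (vs @ rev ws) = \<one>" "set (vs @ rev ws) \<subseteq> I"
    using vs assms by (auto simp: is_word_def word_prod_append word_prod_rev)
  from coxeter_equiv_foldr_reflect[OF presentation[OF this(2,1)]]
  have "foldr reflect vs (foldr reflect (rev ws) (foldr reflect ws \<beta>)) = foldr reflect ws \<beta>"
    by (simp add: fun_eq_iff)
  then show ?thesis
    using foldr_reflect_rev[of "rev ws" \<beta>] sets(2) by (simp add: act_def vs_def)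
qed

section \<open>The linear action of the group on the root space\<close>

lemma act_one [simp]: "act \<one> \<beta> = \<beta>"
  using act_word[of "[]" "\<one>"] by (simp add: is_word_def)

lemma act_s: "i \<in> I \<Longrightarrow> act (s i) \<beta> = reflect i \<beta>"
  using act_word[of "[i]" "s i"] by (simp add: is_word_def refl_closed)

lemma act_mult:
  assumes "v \<in> carrier W" "w \<in> carrier W"
  shows "act (v \<otimes> w) \<beta> = act v (act w \<beta>)"
proof -
  obtain xs ys where words: "is_word xs v" "is_word ys w" using assms ex_word by meson
  then have "is_word (xs @ ys) (v \<otimes> w)" by (auto simp: is_word_def word_prod_append)
  from act_word[OF this] show ?thesis by (simp add: act_word[OF words(1)] act_word[OF words(2)])
qed

lemma act_mult_s: "w \<in> carrier W \<Longrightarrow> i \<in> I \<Longrightarrow> act (w \<otimes> s i) \<beta> = act w (reflect i \<beta>)"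
  by (simp add: act_mult act_s refl_closed)

lemma act_s_mult: "w \<in> carrier W \<Longrightarrow> i \<in> I \<Longrightarrow> act (s i \<otimes> w) \<beta> = reflect i (act w \<beta>)"
  by (simp add: act_mult act_s refl_closed)

lemma act_inv_act [simp]: "w \<in> carrier W \<Longrightarrow> act (inv w) (act w \<beta>) = \<beta>"
  by (simp flip: act_mult)

lemma act_act_inv [simp]: "w \<in> carrier W \<Longrightarrow> act w (act (inv w) \<beta>) = \<beta>"
  by (simp flip: act_mult)

lemma act_linear:
  "w \<in> carrier W \<Longrightarrow> act w (\<lambda>x. a * \<beta> x + b * \<gamma> x) = (\<lambda>x. a * act w \<beta> x + b * act w \<gamma> x)"
  using ex_word[of w] by (auto simp: act_word foldr_reflect_linear)

lemma act_uminus: "w \<in> carrier W \<Longrightarrow> act w (\<lambda>x. - \<beta> x) = (\<lambda>x. - act w \<beta> x)"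
  using act_linear[of w "- 1" \<beta> 0 \<beta>] by simp

lemma bilin_act: "w \<in> carrier W \<Longrightarrow> bilin (act w \<beta>) (act w \<gamma>) = bilin \<beta> \<gamma>"
  using ex_word[of w] by (auto simp: act_word bilin_foldr_reflect is_word_def)

lemma act_reflect:
  assumes "w \<in> carrier W"
  shows "act w (reflect i \<beta>)
    = (\<lambda>x. act w \<beta> x - 2 * bilin \<beta> (simple_root i) * act w (simple_root i) x)"
  unfolding reflect_eq act_linear[OF assms] by simp

lemma act_sum:
  assumes "w \<in> carrier W" "finite A"
  shows "act w (\<lambda>x. \<Sum>i\<in>A. c i * \<gamma> i x) = (\<lambda>x. \<Sum>i\<in>A. c i * act w (\<gamma> i) x)"
  using assms(2)
proof (induction rule: finite_induct)
  case empty
  then show ?case using act_linear[OF assms(1), of 0 _ 0] by simp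
next
  case (insert k A)
  then show ?case
    using act_linear[OF assms(1), of "c k" "\<gamma> k" 1 "\<lambda>x. \<Sum>i\<in>A. c i * \<gamma> i x"] by simp
qed

section \<open>Positive roots and lengths\<close>

text \<open>Induction on the length. Write \<open>w\<close> as \<open>v\<close> times an alternating
  word in \<open>i\<close> and a right descent \<open>j\<close> of \<open>w\<close>. The word sends
  \<open>simple_root i\<close> to a nonnegative combination of the two simple roots, and
  \<open>v\<close> sends both of them to nonnegative vectors.\<close>

lemma act_simple_root_nonneg:
  assumes "w \<in> carrier W" "i \<in> I" "cox_length w < cox_length (w \<otimes> s i)" "x \<in> I"
  shows "0 \<le> act w (simple_root i) x"
  using assms
proof (induction "cox_length w" arbitrary: w i rule: less_induct)
  case less
  note w = less.prems(1) and i = less.prems(2)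
  show ?case
  proof (cases "w = \<one>")
    case True
    then show ?thesis by (simp add: simple_root_def)
  next
    case False
    from ex_shorter_mult_s[OF w False] obtain j
      where j: "j \<in> I" and shorter: "cox_length (w \<otimes> s j) < cox_length w" by blast
    have ij: "i \<noteq> j" using less.prems(3) shorter by auto
    have alt: "set (alt_word a b k) \<subseteq> I" if "a \<in> {i, j}" "b \<in> {i, j}" for a b k
      using set_alt_word[of a b k] i j that by blast
    \<comment> \<open>The element \<open>v\<close> below is the shortest element of the coset of \<open>w\<close> modulo the dihedral
      subgroup generated by \<open>s i\<close> and \<open>s j\<close>, so that the induction hypothesis applies to \<open>v\<close> and
      both \<open>i\<close> and \<open>j\<close>; the dihedral factor is computed explicitly.\<close>
    define P where "P v \<longleftrightarrow> v \<in> carrier W \<and> (\<exists>k. w = v \<otimes> word_prod W s (alt_word i j k)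
      \<and> cox_length v + k = cox_length w)" for v
    have "P (w \<otimes> s j)"
      using w j shorter cox_length_mult_s[OF w j]
      by (auto simp: P_def refl_closed intro!: exI[of _ "Suc 0"])
    from ex_has_least_nat[of P, OF this, of cox_length] obtain v
      where "P v" and min: "\<And>u. P u \<Longrightarrow> cox_length v \<le> cox_length u" by blast
    then obtain k where v: "v \<in> carrier W" and w_eq: "w = v \<otimes> word_prod W s (alt_word i j k)"
      and len: "cox_length v + k = cox_length w" by (auto simp: P_def)
    have v_less: "cox_length v < cox_length w" using min[OF \<open>P (w \<otimes> s j)\<close>] shorter by simp
    then obtain k' where k': "k = Suc k'" using len by (cases k) auto
    let ?p = "if even k' then j else i" and ?q = "if even k' then i else j"
    have pq: "?p \<in> I" "?q \<in> I" using i j by auto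
    \<comment> \<open>\<open>?p\<close> is the first letter of the alternating word,
      \<open>?q\<close> the other letter. If \<open>s ?q\<close> shortened \<open>v\<close>, moving
      it into the word would give a factorization with a shorter left factor, against
      minimality.\<close>
    have "cox_length v < cox_length (v \<otimes> s ?q)"
    proof (rule ccontr)
      assume "\<not> ?thesis"
      then have *: "cox_length v = Suc (cox_length (v \<otimes> s ?q))"
        using cox_length_mult_s[OF v pq(2)] by auto
      have "word_prod W s (alt_word i j (Suc k)) = s ?q \<otimes> word_prod W s (alt_word i j k)"
        by (simp add: k')
      then have "w = v \<otimes> s ?q \<otimes> word_prod W s (alt_word i j (Suc k))"
        using v pq w_eq alt[of i j k] by (simp add: refl_closed m_assoc del: alt_word.simps)
      then have "P (v \<otimes> s ?q)"
        unfolding P_def using * len v pq by (auto simp: refl_closed intro!: exI[of _ "Suc k"])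
      from min[OF this] * show False by simp
    qed
    \<comment> \<open>If \<open>s ?p\<close> shortened \<open>v\<close>, absorbing the first letter
      of the word into \<open>v\<close> would save two letters in total.\<close>
    moreover have "cox_length v < cox_length (v \<otimes> s ?p)"
    proof (rule ccontr)
      assume "\<not> ?thesis"
      then have *: "cox_length v = Suc (cox_length (v \<otimes> s ?p))"
        using cox_length_mult_s[OF v pq(1)] by auto
      have "w = v \<otimes> s ?p \<otimes> word_prod W s (alt_word i j k')"
        using v pq w_eq alt[of i j k'] by (simp add: k' refl_closed m_assoc)
      then have "cox_length w \<le> cox_length (v \<otimes> s ?p) + k'"
        using cox_length_mult_le[of "v \<otimes> s ?p" "word_prod W s (alt_word i j k')"]
          cox_length_le[of "alt_word i j k'"] v pq alt[of i j k']
        by (fastforce simp: is_word_def refl_closed)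
      with * len k' show False by simp
    qed
    ultimately have "cox_length v < cox_length (v \<otimes> s i)" "cox_length v < cox_length (v \<otimes> s j)"
      by (auto split: if_splits)
    then have pos: "0 \<le> act v (simple_root i) x" "0 \<le> act v (simple_root j) x"
      using less.hyps[OF v_less v] i j less.prems(4) by auto
    \<comment> \<open>Otherwise the braid relation rewrites the last \<open>m\<close> letters so
      that they end in \<open>i\<close>. That letter cancels against \<open>s i\<close>, making
      \<open>w \<otimes> s i\<close> shorter than \<open>w\<close>.\<close>
    have "k < cox_m i j" if m: "cox_m i j \<noteq> 0"
    proof (rule ccontr)
      assume "\<not> ?thesis"
      then obtain r where k: "k = r + cox_m i j" by (metis add.commute le_add_diff_inverse not_less)
      obtain m' where m': "cox_m i j = Suc m'" using m not0_implies_Suc by blast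
      obtain xs where xs: "alt_word i j k = xs @ alt_word i j (cox_m i j)" "length xs = r"
        "set xs \<subseteq> {i, j}" using alt_word_add k by metis
      let ?x = "word_prod W s (alt_word i j (cox_m i j))"
        and ?y = "word_prod W s (alt_word j i (cox_m i j))"
      have xs_I: "set xs \<subseteq> I" using xs(3) i j by auto
      have "word_prod W s (concat (replicate n [i, j])) = (s i \<otimes> s j) [^] n" for n
      proof (induction n)
        case (Suc n)
        then have "word_prod W s (concat (replicate (Suc n) [i, j]))
            = (s i \<otimes> s j) \<otimes> (s i \<otimes> s j) [^] n"
          using i j by (simp add: refl_closed m_assoc)
        also have "\<dots> = (s i \<otimes> s j) [^] Suc n"
          using i j by (intro nat_pow_Suc2[symmetric]) (simp add: refl_closed)
        finally show ?case .
      qed simp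
      then have "word_prod W s (alt_word i j (2 * cox_m i j)) = \<one>"
        unfolding alt_word_even using i j by (simp add: cox_m_def refl_closed)
      then have "inv ?y \<otimes> ?x = \<one>"
        using alt_word_even_split[of "cox_m i j" "cox_m i j" i j] alt[of i j] alt[of j i]
        by (simp add: word_prod_append word_prod_rev)
      then have "?x = ?y"
        using alt[of i j] alt[of j i] by (metis inv_equality inv_inv insertI1 insertI2 inv_closed word_prod_closed)
      also have "\<dots> = word_prod W s (alt_word i j m') \<otimes> s i"
        unfolding m' alt_word_snoc using alt[of i j m'] i by (simp add: word_prod_append refl_closed)
      finally have "word_prod W s (alt_word i j k) \<otimes> s i = word_prod W s (xs @ alt_word i j m')"
        unfolding xs(1) using xs_I alt[of i j] i
        by (simp add: word_prod_append refl_closed m_assoc)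
      then have "w \<otimes> s i = v \<otimes> word_prod W s (xs @ alt_word i j m')"
        using v i alt[of i j k] by (simp add: w_eq refl_closed m_assoc)
      moreover have "cox_length (word_prod W s (xs @ alt_word i j m')) \<le> r + m'"
        using cox_length_le[of "xs @ alt_word i j m'"] xs(2) xs_I alt[of i j m']
        by (simp add: is_word_def)
      ultimately have "cox_length (w \<otimes> s i) \<le> cox_length v + (r + m')"
        using cox_length_mult_le[OF v, of "word_prod W s (xs @ alt_word i j m')"] xs_I alt[of i j m']
        by simp
      then show False using less.prems(3) len k m' by simp
    qed
    \<comment> \<open>The strict bound matters: both depths \<open>k\<close> and
      \<open>k + 1\<close> occur and must not exceed the order.\<close>
    then have "0 \<le> dihedral_coeff i j k" "0 \<le> dihedral_coeff i j (Suc k)"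
      using dihedral_coeff_nonneg[OF i j ij] by (meson Suc_leI less_imp_le)+
    moreover have "act w (simple_root i) = act v (foldr reflect (alt_word i j k) (simple_root i))"
      unfolding w_eq using v alt[of i j k]
      by (simp add: act_mult act_word[of "alt_word i j k"] is_word_def)
    ultimately show ?thesis
      using pos unfolding foldr_reflect_alt_word[OF i j ij] act_linear[OF v] by auto
  qed
qed

section \<open>Roots and their signs\<close>

lemma bilin_root: "\<beta> \<in> roots \<Longrightarrow> bilin \<beta> \<beta> = 1"
  by (auto simp: roots_def bilin_act bilin_simple gram_self)

lemma act_root:
  assumes "w \<in> carrier W" "\<beta> \<in> roots"
  shows "act w \<beta> \<in> roots"
proof -
  obtain v i where "v \<in> carrier W" "i \<in> I" "\<beta> = act v (simple_root i)"
    using assms(2) by (auto simp: roots_def)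
  then have "act w \<beta> = act (w \<otimes> v) (simple_root i)" "w \<otimes> v \<in> carrier W" "i \<in> I"
    using assms(1) by (simp_all add: act_mult)
  then show ?thesis unfolding roots_def by blast
qed

lemma simple_root_pos: "i \<in> I \<Longrightarrow> simple_root i \<in> pos_roots"
  unfolding pos_roots_def roots_def
  by (auto simp: simple_root_def intro!: exI[of _ "\<one>"] exI[of _ i])

lemma pos_rootsD: "\<beta> \<in> pos_roots \<Longrightarrow> \<beta> \<in> roots" "\<beta> \<in> pos_roots \<Longrightarrow> i \<in> I \<Longrightarrow> 0 \<le> \<beta> i"
  by (auto simp: pos_roots_def)

lemma reflect_root: "i \<in> I \<Longrightarrow> \<beta> \<in> roots \<Longrightarrow> reflect i \<beta> \<in> roots"
  using act_root[of "s i" \<beta>] by (simp add: act_s refl_closed)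

lemma uminus_root:
  assumes "\<beta> \<in> roots"
  shows "(\<lambda>x. - \<beta> x) \<in> roots"
proof -
  obtain w i where w: "w \<in> carrier W" "i \<in> I" "\<beta> = act w (simple_root i)"
    using assms by (auto simp: roots_def)
  then have "(\<lambda>x. - \<beta> x) = act (w \<otimes> s i) (simple_root i)"
    by (simp add: act_mult_s reflect_simple_self act_uminus)
  then show ?thesis using w unfolding roots_def by (blast intro: m_closed refl_closed)
qed

lemma root_outside:
  assumes "\<beta> \<in> roots" "x \<notin> I"
  shows "\<beta> x = 0"
proof -
  obtain w i where w: "w \<in> carrier W" "i \<in> I" "\<beta> = act w (simple_root i)"
    using assms(1) by (auto simp: roots_def)
  obtain ws where ws: "is_word ws w" using ex_word[OF w(1)] ..
  have "foldr reflect vs (simple_root i) x = 0" if "set vs \<subseteq> I" for vs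
    using that assms(2) w(2) by (induction vs) (auto simp: reflect_def simple_root_def)
  then show ?thesis using ws w(3) by (simp add: act_word is_word_def)
qed

lemma act_simple_root_nonpos:
  assumes "w \<in> carrier W" "i \<in> I" "cox_length (w \<otimes> s i) < cox_length w" "x \<in> I"
  shows "act w (simple_root i) x \<le> 0"
proof -
  have "0 \<le> act (w \<otimes> s i) (simple_root i) x"
    using assms by (intro act_simple_root_nonneg) (simp_all add: refl_closed)
  then show ?thesis using assms by (simp add: act_mult_s reflect_simple_self act_uminus)
qed

text \<open>Whether \<open>s i\<close> lengthens or shortens \<open>w\<close> decides the sign of
  all coordinates of the root. Both signs together would give the zero vector, but roots have norm
  one.\<close>

lemma not_pos_root_iff:
  assumes "\<beta> \<in> roots"
  shows "\<beta> \<notin> pos_roots \<longleftrightarrow> (\<forall>x\<in>I. \<beta> x \<le> 0)"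
proof
  obtain w i where w: "w \<in> carrier W" "i \<in> I" "\<beta> = act w (simple_root i)"
    using assms by (auto simp: roots_def)
  consider "cox_length w < cox_length (w \<otimes> s i)" | "cox_length (w \<otimes> s i) < cox_length w"
    using cox_length_mult_s[OF w(1,2)] by linarith
  then have "(\<forall>x\<in>I. 0 \<le> \<beta> x) \<or> (\<forall>x\<in>I. \<beta> x \<le> 0)"
    using w act_simple_root_nonneg act_simple_root_nonpos by cases auto
  then show "\<beta> \<notin> pos_roots \<Longrightarrow> \<forall>x\<in>I. \<beta> x \<le> 0" using assms by (auto simp: pos_roots_def)
  show "\<beta> \<notin> pos_roots" if "\<forall>x\<in>I. \<beta> x \<le> 0"
  proof
    assume "\<beta> \<in> pos_roots"
    with that have "\<forall>x\<in>I. \<beta> x = 0" by (force simp: pos_roots_def)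
    then have "bilin \<beta> \<beta> = 0" by (simp add: bilin_def)
    with bilin_root[OF assms] show False by simp
  qed
qed

lemma uminus_pos_iff:
  assumes "\<beta> \<in> roots"
  shows "(\<lambda>x. - \<beta> x) \<in> pos_roots \<longleftrightarrow> \<beta> \<notin> pos_roots"
  using not_pos_root_iff[OF assms] uminus_root[OF assms] by (simp add: pos_roots_def)

text \<open>Only the coordinate at \<open>i\<close> changes. If the sign changed, all other
  coordinates would vanish, and norm one would leave only \<open>simple_root i\<close>.\<close>

lemma reflect_pos_root:
  assumes i: "i \<in> I" and \<beta>: "\<beta> \<in> pos_roots" "\<beta> \<noteq> simple_root i"
  shows "reflect i \<beta> \<in> pos_roots"
proof (rule ccontr)
  note root = pos_rootsD(1)[OF \<beta>(1)]
  assume "reflect i \<beta> \<notin> pos_roots"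
  then have le: "\<forall>x\<in>I. reflect i \<beta> x \<le> 0"
    using not_pos_root_iff[OF reflect_root[OF i root]] by blast
  have "\<beta> x \<le> 0" if "x \<in> I" "x \<noteq> i" for x
    using bspec[OF le that(1)] that(2) by (simp add: reflect_def simple_root_def)
  then have zero: "\<beta> x = 0" if "x \<noteq> i" for x
    using that root_outside[OF root] pos_rootsD(2)[OF \<beta>(1)] by (cases "x \<in> I") (simp_all add: antisym)
  define c where "c = \<beta> i"
  have \<beta>_eq: "\<beta> = (\<lambda>x. c * simple_root i x + 0 * simple_root i x)"
    using zero by (auto simp: c_def simple_root_def)
  have "bilin \<beta> \<beta> = c\<^sup>2"
    unfolding \<beta>_eq bilin_linear_left bilin_linear_right
    by (simp add: bilin_simple gram_self i power2_eq_square)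
  then have "c = 1"
    using bilin_root[OF root] pos_rootsD(2)[OF \<beta>(1) i] by (simp add: power2_eq_1_iff c_def)
  with \<beta>_eq have "\<beta> = simple_root i" by simp
  with \<beta>(2) show False ..
qed

lemma act_simple_root_pos:
  "w \<in> carrier W \<Longrightarrow> i \<in> I \<Longrightarrow> cox_length w < cox_length (w \<otimes> s i) \<Longrightarrow> act w (simple_root i) \<in> pos_roots"
  by (simp add: pos_roots_def act_simple_root_nonneg act_root pos_rootsD(1)[OF simple_root_pos])

lemma act_eq_sum:
  assumes "w \<in> carrier W" "\<beta> \<in> roots"
  shows "act w \<beta> = (\<lambda>x. \<Sum>i\<in>I. \<beta> i * act w (simple_root i) x)"
proof -
  have eq: "(\<lambda>x. \<Sum>i\<in>I. \<beta> i * simple_root i x) = \<beta>"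
  proof
    fix x
    have "(\<Sum>i\<in>I. \<beta> i * simple_root i x) = (\<Sum>i\<in>I. if x = i then \<beta> i else 0)"
      by (intro sum.cong) (auto simp: simple_root_def)
    then show "(\<Sum>i\<in>I. \<beta> i * simple_root i x) = \<beta> x"
      using root_outside[OF assms(2)] finite_index by simp
  qed
  show ?thesis using act_sum[OF assms(1) finite_index, of \<beta> simple_root] unfolding eq .
qed

text \<open>All simple roots go to nonpositive vectors, hence so does every nonnegative combination.
  Assuming descents instead of \<open>w = long_element\<close> allows use in the uniqueness proof
  for the longest element.\<close>

lemma act_pos_not_pos:
  assumes "w \<in> carrier W" "\<And>i. i \<in> I \<Longrightarrow> cox_length (w \<otimes> s i) < cox_length w" "\<beta> \<in> pos_roots"
  shows "act w \<beta> \<notin> pos_roots"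
proof -
  note root = pos_rootsD(1)[OF assms(3)]
  have "act w \<beta> x \<le> 0" if "x \<in> I" for x
    unfolding act_eq_sum[OF assms(1) root]
    using assms that pos_rootsD(2) act_simple_root_nonpos
    by (intro sum_nonpos mult_nonneg_nonpos) auto
  then show ?thesis using not_pos_root_iff[OF act_root[OF assms(1) root]] by blast
qed

lemma act_not_pos_pos:
  assumes "w \<in> carrier W" "\<And>i. i \<in> I \<Longrightarrow> cox_length (w \<otimes> s i) < cox_length w"
    "\<beta> \<in> roots" "\<beta> \<notin> pos_roots"
  shows "act w \<beta> \<in> pos_roots"
proof -
  have "act w (\<lambda>x. - \<beta> x) \<notin> pos_roots"
    using assms by (intro act_pos_not_pos) (simp_all add: uminus_pos_iff)
  then show ?thesis using assms uminus_pos_iff[OF act_root[OF assms(1,3)]] by (simp add: act_uminus)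
qed

section \<open>The long element\<close>

text \<open>The \<open>THE\<close> needs uniqueness. For distinct longest \<open>v\<close> and
  \<open>w\<close>, a right descent \<open>i\<close> of \<open>v \<otimes> inv w\<close> makes the
  image of \<open>simple_root i\<close> negative; but \<open>inv w\<close> and \<open>v\<close> each
  reverse signs, so that image is positive.\<close>

lemma long_element_props:
  assumes "finite (carrier W)"
  shows "long_element \<in> carrier W"
    and "i \<in> I \<Longrightarrow> cox_length (long_element \<otimes> s i) < cox_length long_element"
proof -
  define longest where "longest w \<longleftrightarrow> w \<in> carrier W \<and> (\<forall>v\<in>carrier W. cox_length v \<le> cox_length w)"
    for w
  have descent: "cox_length (w \<otimes> s i) < cox_length w" if "longest w" "i \<in> I" for w i
    using that cox_length_mult_s[of w i] unfolding longest_def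
    by (metis Suc_n_not_le_n lessI m_closed refl_closed)
  have inv_longest: "longest (inv w)" if "longest w" for w
    using that by (auto simp: longest_def cox_length_inv)
  have unique: "v = w" if v: "longest v" and w: "longest w" for v w
  proof (rule ccontr)
    have closed: "v \<in> carrier W" "w \<in> carrier W" using v w by (auto simp: longest_def)
    assume "v \<noteq> w"
    then have "v \<otimes> inv w \<noteq> \<one>" using closed by (metis inv_closed inv_equality inv_inv)
    then obtain i where i: "i \<in> I" and less: "cox_length (v \<otimes> inv w \<otimes> s i) < cox_length (v \<otimes> inv w)"
      using ex_shorter_mult_s[of "v \<otimes> inv w"] closed by auto
    have root: "simple_root i \<in> roots" by (rule pos_rootsD(1)[OF simple_root_pos[OF i]])
    have "act (inv w) (simple_root i) \<notin> pos_roots"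
      using closed inv_longest[OF w] i by (intro act_pos_not_pos descent simple_root_pos) auto
    then have "act v (act (inv w) (simple_root i)) \<in> pos_roots"
      using closed v root by (intro act_not_pos_pos descent act_root) auto
    moreover have "act (v \<otimes> inv w) (simple_root i) x \<le> 0" if "x \<in> I" for x
      using act_simple_root_nonpos[OF _ i less that] closed by simp
    ultimately show False
      using closed root not_pos_root_iff[OF act_root[of "v \<otimes> inv w" "simple_root i"]]
      by (simp add: act_mult)
  qed
  have "Max (cox_length ` carrier W) \<in> cox_length ` carrier W"
    using assms one_closed by (intro Max_in) auto
  then obtain w where "w \<in> carrier W" "cox_length w = Max (cox_length ` carrier W)" by auto
  then have "longest w" using assms by (simp add: longest_def)
  then have "longest (THE w. longest w)" using unique by (blast intro: theI)
  then have "longest long_element" by (simp add: longest_def long_element_def)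
  then show "long_element \<in> carrier W"
    and "i \<in> I \<Longrightarrow> cox_length (long_element \<otimes> s i) < cox_length long_element"
    using descent by (auto simp: longest_def)
qed

section \<open>Toggles\<close>

lemma root_set_act_pos: "\<beta> \<in> root_set L \<Longrightarrow> u \<in> L \<Longrightarrow> act u \<beta> \<in> pos_roots"
  by (auto simp: root_set_def half_space_def)

text \<open>Any family of roots that defines \<open>L\<close> lies in \<open>root_set L\<close>, so
  the largest family cuts out the same set.\<close>

lemma convex_iff_root_set:
  assumes "is_convex L"
  shows "u \<in> L \<longleftrightarrow> u \<in> carrier W \<and> (\<forall>\<beta>\<in>root_set L. act u \<beta> \<in> pos_roots)"
proof -
  obtain A where "A \<subseteq> roots" "L = carrier W \<inter> (\<Inter>\<beta>\<in>A. half_space \<beta>)"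
    using assms by (auto simp: is_convex_def)
  then show ?thesis by (auto simp: root_set_def half_space_def)
qed

section \<open>Toggles, half-spaces and convex sets\<close>

lemma toggle_closed: "u \<in> carrier W \<Longrightarrow> i \<in> I \<Longrightarrow> toggle L i u \<in> carrier W"
  by (simp add: toggle_def refl_closed)

lemma foldr_toggle_closed: "set ws \<subseteq> I \<Longrightarrow> u \<in> carrier W \<Longrightarrow> foldr (toggle L) ws u \<in> carrier W"
  by (induction ws) (auto simp: toggle_closed)

text \<open>The only positive root made negative by \<open>s i\<close> is
  \<open>simple_root i\<close>. If \<open>act u \<beta>\<close> were that root, the tested root
  would be \<open>\<beta>\<close> itself and the toggle would fix \<open>u\<close>.\<close>

lemma toggle_half_space:
  assumes "u \<in> carrier W" "i \<in> I" "\<beta> \<in> root_set L" "act u \<beta> \<in> pos_roots"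
  shows "act (toggle L i u) \<beta> \<in> pos_roots"
proof (cases "act (inv u) (simple_root i) \<in> root_set L")
  case False
  then have "act u \<beta> \<noteq> simple_root i" using act_inv_act[OF assms(1), of \<beta>] assms(3) by auto
  then show ?thesis using assms False by (simp add: toggle_def act_s_mult reflect_pos_root)
qed (simp add: toggle_def assms)

lemma toggle_convex:
  assumes "is_convex L" "u \<in> L" "i \<in> I"
  shows "toggle L i u \<in> L"
  using assms convex_iff_root_set toggle_closed toggle_half_space by blast

text \<open>After a move the tested root is the negative of the previous one. Since
  \<open>u \<in> L\<close> sends it to a negative simple root, it is not in
  \<open>root_set L\<close>, and the second toggle moves back.\<close>

lemma toggle_toggle:
  assumes "is_convex L" "u \<in> L" "i \<in> I"
  shows "toggle L i (toggle L i u) = u"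
proof (cases "act (inv u) (simple_root i) \<in> root_set L")
  case False
  have u: "u \<in> carrier W" using assms convex_iff_root_set by blast
  have root: "simple_root i \<in> roots" by (rule pos_rootsD(1)[OF simple_root_pos[OF assms(3)]])
  have eq: "act (inv (s i \<otimes> u)) (simple_root i) = (\<lambda>x. - act (inv u) (simple_root i) x)"
    using u assms(3)
    by (simp add: inv_mult_group refl_closed act_mult_s reflect_simple_self act_uminus)
  have "act (inv (s i \<otimes> u)) (simple_root i) \<notin> root_set L"
  proof
    assume "act (inv (s i \<otimes> u)) (simple_root i) \<in> root_set L"
    from root_set_act_pos[OF this assms(2)] have "(\<lambda>x. - simple_root i x) \<in> pos_roots"
      unfolding eq using u by (simp add: act_uminus)
    then show False using uminus_pos_iff[OF root] simple_root_pos[OF assms(3)] by blast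
  qed
  then show ?thesis using False u assms(3) by (simp add: toggle_def)
qed (simp add: toggle_def)

lemma foldr_toggle_convex:
  assumes "is_convex L" "set ws \<subseteq> I"
  shows "foldr (toggle L) ws ` L = L"
  using assms(2)
proof (induction ws)
  case (Cons i ws)
  have "toggle L i ` L = L"
  proof
    show "toggle L i ` L \<subseteq> L" using Cons.prems toggle_convex[OF assms(1)] by auto
    show "L \<subseteq> toggle L i ` L"
    proof
      fix u assume "u \<in> L"
      then show "u \<in> toggle L i ` L"
        using Cons.prems toggle_convex[OF assms(1)] toggle_toggle[OF assms(1)]
        by (intro image_eqI[of _ _ "toggle L i u"]) auto
    qed
  qed
  moreover have "foldr (toggle L) (i # ws) ` L = toggle L i ` foldr (toggle L) ws ` L"
    by (simp add: image_image)
  ultimately show ?case using Cons by simp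
qed simp

text \<open>The disjunction of the overview, as an implication. It is stated for any reduced word so
  that it passes to tails, and \<open>\<beta>\<close> is arbitrary because the induction hypothesis
  may be needed for another root.\<close>

lemma foldr_toggle_invariant:
  assumes "is_reduced_word ws (word_prod W s ws)" "u \<in> carrier W" "L \<noteq> {}" "\<beta> \<in> root_set L"
    and "act (foldr (toggle L) ws u) \<beta> \<notin> pos_roots"
  shows "act (inv (word_prod W s ws)) (act (foldr (toggle L) ws u) \<beta>) \<notin> pos_roots"
  using assms(1,4,5)
proof (induction ws arbitrary: \<beta>)
  case Nil
  then show ?case by simp
next
  case (Cons i ws)
  define v where "v = foldr (toggle L) ws u"
  define w where "w = word_prod W s ws"
  note \<beta> = Cons.prems(2)
  have i: "i \<in> I" and ws: "set ws \<subseteq> I"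
    using Cons.prems(1) by (auto simp: is_reduced_word_def is_word_def)
  have v: "v \<in> carrier W" using foldr_toggle_closed[OF ws assms(2)] by (simp add: v_def)
  have w: "w \<in> carrier W" using ws by (simp add: w_def)
  have IH: "act (inv w) (act v \<gamma>) \<notin> pos_roots"
    if "\<gamma> \<in> root_set L" "act v \<gamma> \<notin> pos_roots" for \<gamma>
    using Cons.IH[OF reduced_word_tl(1)[OF Cons.prems(1)]] that by (simp add: v_def w_def)
  have root: "\<gamma> \<in> roots" if "\<gamma> \<in> root_set L" for \<gamma> using that by (simp add: root_set_def)
  have not_pos: "act (toggle L i v) \<beta> \<notin> pos_roots" using Cons.prems(3) by (simp add: v_def)
  then have v\<beta>: "act v \<beta> \<notin> pos_roots" using toggle_half_space[OF v i \<beta>] by blast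
  \<comment> \<open>This is the goal, since
    \<open>inv (s i \<otimes> w) = inv w \<otimes> s i\<close>. If the toggle moves
    \<open>v\<close>, the two reflections cancel.\<close>
  have "act (inv w) (reflect i (act (toggle L i v) \<beta>)) \<notin> pos_roots"
  proof (cases "act (inv v) (simple_root i) \<in> root_set L")
    case False
    then show ?thesis
      using IH[OF \<beta> v\<beta>] v i by (simp add: toggle_def act_s_mult reflect_reflect)
  next
    case True
    let ?\<beta>' = "act (inv v) (simple_root i)" and ?\<gamma> = "reflect i (act v \<beta>)"
    let ?c = "bilin (act v \<beta>) (simple_root i)"
    have v_root: "act v \<beta> \<in> roots" using act_root v root \<beta> by blast
    have \<gamma>_root: "?\<gamma> \<in> roots" using reflect_root i v_root .
    have "act (inv w) ?\<gamma> \<notin> pos_roots"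
    proof (cases "0 \<le> ?c")
      case True
      \<comment> \<open>Here reducedness enters: \<open>inv w\<close> sends
        \<open>simple_root i\<close> to a positive root, and subtracting a nonnegative multiple of
        it keeps the coordinates nonpositive.\<close>
      have "cox_length (inv w) < cox_length (inv w \<otimes> s i)"
        using reduced_word_tl(2)[OF Cons.prems(1)] w i cox_length_inv[of w] cox_length_inv[of "s i \<otimes> w"]
        by (simp add: inv_mult_group refl_closed flip: w_def)
      then have pos: "act (inv w) (simple_root i) \<in> pos_roots"
        using act_simple_root_pos w i by simp
      have "\<forall>x\<in>I. act (inv w) (act v \<beta>) x \<le> 0"
        using IH[OF \<beta> v\<beta>] not_pos_root_iff act_root[OF inv_closed[OF w] v_root] by blast
      then have "\<forall>x\<in>I. act (inv w) ?\<gamma> x \<le> 0"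
        using w True pos_rootsD(2)[OF pos]
        by (auto simp: act_reflect intro: order_trans[OF _ mult_nonneg_nonneg])
      then show ?thesis using not_pos_root_iff[OF act_root[OF inv_closed[OF w] \<gamma>_root]] by blast
    next
      case False
      \<comment> \<open>\<open>\<delta>\<close> is the reflection of \<open>\<beta>\<close> in
        \<open>?\<beta>'\<close>. As \<open>?c < 0\<close>, it is a nonnegative combination of two
        members of \<open>root_set L\<close>, hence a member itself.\<close>
      define \<delta> where "\<delta> = act (inv v) ?\<gamma>"
      have \<delta>: "\<delta> = (\<lambda>x. \<beta> x - 2 * ?c * ?\<beta>' x)"
        using v by (simp add: \<delta>_def act_reflect)
      have \<delta>_root: "\<delta> \<in> roots" unfolding \<delta>_def using act_root v \<gamma>_root by simp
      have v\<delta>: "act v \<delta> = ?\<gamma>" using v by (simp add: \<delta>_def)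
      have carrier: "x \<in> carrier W" if "x \<in> L" for x
        using that \<beta> by (auto simp: root_set_def half_space_def)
      have "act x \<delta> \<in> pos_roots" if "x \<in> L" for x
      proof -
        have "act x \<delta> = (\<lambda>y. 1 * act x \<beta> y + (- 2 * ?c) * act x ?\<beta>' y)"
          using act_linear[OF carrier[OF that], of 1 \<beta> "- 2 * ?c" ?\<beta>'] by (simp add: \<delta>)
        moreover have "0 \<le> act x \<beta> y" "0 \<le> act x ?\<beta>' y" if "y \<in> I" for y
          using root_set_act_pos[OF _ \<open>x \<in> L\<close>] \<beta> \<open>?\<beta>' \<in> root_set L\<close> pos_rootsD(2) that by blast+
        ultimately show ?thesis
          using False act_root[OF carrier[OF that] \<delta>_root] by (auto simp: pos_roots_def intro: order_trans[OF mult_nonpos_nonneg])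
      qed
      then have \<delta>_L: "\<delta> \<in> root_set L"
        using \<delta>_root carrier by (auto simp: root_set_def half_space_def)
      \<comment> \<open>A positive \<open>?\<gamma>\<close> would be \<open>simple_root i\<close>,
        so \<open>\<beta>\<close> and \<open>?\<beta>'\<close> would be opposite roots, both
        positive at a point of the nonempty set \<open>L\<close>.\<close>
      have "?\<gamma> \<notin> pos_roots"
      proof
        assume "?\<gamma> \<in> pos_roots"
        moreover have "reflect i ?\<gamma> \<notin> pos_roots" using v\<beta> i by (simp add: reflect_reflect)
        ultimately have "?\<gamma> = simple_root i" using reflect_pos_root i by blast
        then have "act v \<beta> = (\<lambda>x. - simple_root i x)"
          using reflect_reflect[OF i, of "act v \<beta>"] by (simp add: reflect_simple_self i)
        then have "act (inv v) (act v \<beta>) = (\<lambda>x. - ?\<beta>' x)" using v by (simp add: act_uminus)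
        then have \<beta>_eq: "\<beta> = (\<lambda>x. - ?\<beta>' x)" using v by simp
        obtain x where "x \<in> L" using assms(3) by blast
        have "(\<lambda>y. - act x ?\<beta>' y) \<in> pos_roots"
          using root_set_act_pos[OF \<beta> \<open>x \<in> L\<close>]
          unfolding \<beta>_eq act_uminus[OF carrier[OF \<open>x \<in> L\<close>]] .
        then show False
          using uminus_pos_iff[of "act x ?\<beta>'"] root_set_act_pos[OF True \<open>x \<in> L\<close>] pos_rootsD(1) by blast
      qed
      then show ?thesis using IH[OF \<delta>_L] v\<delta> by simp
    qed
    then show ?thesis using True by (simp add: toggle_def)
  qed
  then show ?case
    using v w i by (simp add: inv_mult_group refl_closed act_mult_s flip: v_def w_def)
qed

lemma image_foldr_toggle:
  assumes fin: "finite (carrier W)" and red: "is_reduced_word ws long_element"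
    and conv: "is_convex L" and "L \<noteq> {}"
  shows "foldr (toggle L) ws ` carrier W = L"
proof
  have ws: "set ws \<subseteq> I" and prod: "word_prod W s ws = long_element"
    using red by (auto simp: is_reduced_word_def is_word_def)
  note long = long_element_props[OF fin]
  have "L \<subseteq> carrier W" using convex_iff_root_set[OF conv] by blast
  then show "L \<subseteq> foldr (toggle L) ws ` carrier W"
    using foldr_toggle_convex[OF conv ws] by blast
  show "foldr (toggle L) ws ` carrier W \<subseteq> L"
  proof
    fix v assume "v \<in> foldr (toggle L) ws ` carrier W"
    then obtain u where u: "u \<in> carrier W" and v: "v = foldr (toggle L) ws u" by blast
    have v_closed: "v \<in> carrier W" using foldr_toggle_closed[OF ws u] v by simp
    have "act v \<beta> \<in> pos_roots" if \<beta>: "\<beta> \<in> root_set L" for \<beta>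
    proof (rule ccontr)
      assume neg: "act v \<beta> \<notin> pos_roots"
      have root: "act (inv long_element) (act v \<beta>) \<in> roots"
        using \<beta> v_closed long(1) by (auto simp: root_set_def intro!: act_root)
      have "act (inv long_element) (act v \<beta>) \<notin> pos_roots"
        using foldr_toggle_invariant[of ws u L \<beta>] red u assms(4) \<beta> neg by (simp add: prod v)
      \<comment> \<open>The long element turns this nonpositive root into a positive one, but its
        image is \<open>act v \<beta>\<close>.\<close>
      from act_not_pos_pos[OF long root this] neg show False using long(1) by simp
    qed
    then show "v \<in> L" using v_closed convex_iff_root_set[OF conv] by blast
  qed
qed

end

theorem theorem1p22:
  fixes W :: "('a, 'b) monoid_scheme" and I :: "'i set" and s :: "'i \<Rightarrow> 'a"
    and ws :: "'i list" and L :: "'a set"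
  assumes "coxeter_system W I s"
    and "finite (carrier W)"
    and "coxeter_system.is_reduced_word W I s ws (coxeter_system.long_element W I s)"
    and "coxeter_system.is_convex W I s L"
    and "L \<noteq> {}"
  shows "foldr (coxeter_system.toggle W I s L) ws ` carrier W = L"
  using assms coxeter_system.image_foldr_toggle by blast

end
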